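(* Let $\theta\mapsto p(\theta)$, $\theta\in U\subset\mathbb{R}^m$, be a smooth $m$-dimensional family of probability densities on $\mathbb{R}^n$ in the Hellinger sense. Then projecting the Zakai equation in the Hellinger metric onto this family gives the same projection filter as projecting the Kushner--Stratonovich equation in the Hellinger metric. That is, for every $\theta\in U$ and every $t$, writing $p=p(\theta)$ and $\Pi_H$ for the orthogonal projection of $L^2(\mathbb{R}^n)$ onto $\mathrm{span}\{\partial_{\theta_1}\sqrt p,\dots,\partial_{\theta_m}\sqrt p\}$, $$\Pi_H\Big[\frac{\mathcal{L}_t^*p-\frac12\big(|b_t|^2-E_p\{|b_t|^2\}\big)p}{2\sqrt p}\Big]=\Pi_H\Big[\frac{\mathcal{L}_t^*p-\frac12|b_t|^2p}{2\sqrt p}\Big],$$ $$\Pi_H\Big[\frac{\big(b_t^k-E_p\{b_t^k\}\big)p}{2\sqrt p}\Big]=\Pi_H\Big[\frac{b_t^kp}{2\sqrt p}\Big],\qquad k=1,\dots,d,$$ so that both projections yield the same Stratonovich stochastic differential equation for $\theta$.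
   Context: Filtering problem: $dX_t=f_t(X_t)\,dt+\sigma_t(X_t)\,dW_t$ in $\mathbb{R}^n$, $dY_t=b_t(X_t)\,dt+dV_t$ in $\mathbb{R}^d$, with $W,V$ independent Brownian motions ($V$ standard) independent of $X_0$; $a_t=\sigma_t\sigma_t^T$ and $$\mathcal{L}_t^*\phi=-\sum_{i=1}^n\frac{\partial}{\partial x_i}[f_t^i\phi]+\frac12\sum_{i,j=1}^n\frac{\partial^2}{\partial x_i\partial x_j}[a_t^{ij}\phi].$$ For a density $p$, $E_p\{g\}=\int g\,p\,dx$. In Stratonovich form, the Kushner--Stratonovich equation for the normalized conditional density is $$dp_t=\mathcal{L}_t^*p_t\,dt-\tfrac12p_t\big[|b_t|^2-E_{p_t}\{|b_t|^2\}\big]dt+\sum_{k=1}^dp_t\big[b_t^k-E_{p_t}\{b_t^k\}\big]\circ dY_t^k,$$ and the Zakai equation for the unnormalized conditional density is $$dq_t=\mathcal{L}_t^*q_t\,dt-\tfrac12q_t|b_t|^2\,dt+\sum_{k=1}^dq_t\,b_t^k\circ dY_t^k,\qquad q_0=p_0.$$ A smooth $m$-dimensional family in the Hellinger sense is a family of probability densities $p(\theta)>0$ (a.e.), $\theta$ in an open set $U\subset\mathbb{R}^m$, such that $\theta\mapsto\sqrt{p(\theta)}\in L^2(\mathbb{R}^n)$ is a smooth (Fréchet) map whose partial derivatives $\partial_{\theta_i}\sqrt{p}=\frac{1}{2\sqrt p}\partial_{\theta_i}p$ are linearly independent at each point. Projecting an equation $dp=A(p)\,dt+\sum_kB^k(p)\circ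 dY^k$ in the Hellinger metric means: rewrite it by the chain rule as an equation for $\sqrt p$, with coefficients $A(p)/(2\sqrt p)$ and $B^k(p)/(2\sqrt p)$; evaluate these at $p=p(\theta)$; project them orthogonally in $L^2(\mathbb{R}^n)$ onto the tangent space $\mathrm{span}\{\partial_{\theta_i}\sqrt p\}$; and read off the coefficients with respect to the basis $\partial_{\theta_i}\sqrt p$ as the coefficients of a Stratonovich SDE for $\theta$. It is a standing assumption that the coefficient functions being projected are well defined in $L^2(\mathbb{R}^n)$, i.e. that $\mathcal{L}^*_tp/\sqrt p$, $|b_t|^2\sqrt p$ and $b_t^k\sqrt p$ lie in $L^2(\mathbb{R}^n)$ for $p=p(\theta)$. *)

theory Defs
  imports "HOL-Analysis.Analysis"
begin

section \<open>The Hilbert space of square-integrable functions\<close>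

definition square_integrable :: "('a::euclidean_space \<Rightarrow> real) \<Rightarrow> bool" where
  "square_integrable f \<longleftrightarrow>
     f \<in> borel_measurable lebesgue \<and> integrable lebesgue (\<lambda>x. (f x)\<^sup>2)"

lemma square_integrable_zero: "square_integrable (\<lambda>x. 0)"
  by (simp add: square_integrable_def)

lemma square_integrable_mult:
  assumes "square_integrable f" "square_integrable g"
  shows "integrable lebesgue (\<lambda>x. f x * g x)"
proof (rule Bochner_Integration.integrable_bound)
  show "integrable lebesgue (\<lambda>x. (f x)\<^sup>2 + (g x)\<^sup>2)"
    using assms by (simp add: square_integrable_def)
  show "(\<lambda>x. f x * g x) \<in> borel_measurable lebesgue"
    using assms by (auto simp: square_integrable_def)
  have "\<bar>u * v\<bar> \<le> u\<^sup>2 + v\<^sup>2" for u v :: real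
  proof -
    have "2 * (\<bar>u\<bar> * \<bar>v\<bar>) \<le> u\<^sup>2 + v\<^sup>2"
      using sum_squares_bound[of "\<bar>u\<bar>" "\<bar>v\<bar>"] by (simp add: algebra_simps)
    moreover have "0 \<le> \<bar>u\<bar> * \<bar>v\<bar>" by simp
    ultimately show ?thesis unfolding abs_mult by linarith
  qed
  then show "AE x in lebesgue. norm (f x * g x) \<le> norm ((f x)\<^sup>2 + (g x)\<^sup>2)"
    by auto
qed

lemma square_integrable_add:
  assumes "square_integrable f" "square_integrable g"
  shows "square_integrable (\<lambda>x. f x + g x)"
proof -
  have "integrable lebesgue (\<lambda>x. (f x)\<^sup>2 + (g x)\<^sup>2 + 2 * (f x * g x))"
    using assms square_integrable_mult[OF assms] by (simp add: square_integrable_def)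
  then show ?thesis
    using assms by (auto simp: square_integrable_def power2_sum mult.assoc)
qed

lemma square_integrable_scale:
  "square_integrable f \<Longrightarrow> square_integrable (\<lambda>x. c * f x)"
  by (auto simp: square_integrable_def power_mult_distrib)

quotient_type (overloaded) 'a l2 = "'a::euclidean_space \<Rightarrow> real" / partial:
  "\<lambda>f g. square_integrable f \<and> square_integrable g \<and> (AE x in lebesgue. f x = g x)"
proof (rule part_equivpI)
  show "\<exists>f::'a \<Rightarrow> real. square_integrable f \<and> square_integrable f \<and> (AE x in lebesgue. f x = f x)"
    using square_integrable_zero by auto
qed (auto simp: symp_def transp_def elim: AE_mp)

instantiation l2 :: (euclidean_space) real_vector
begin

lift_definition zero_l2 :: "'a l2" is "\<lambda>x. 0"
  by (simp add: square_integrable_zero)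

lift_definition plus_l2 :: "'a l2 \<Rightarrow> 'a l2 \<Rightarrow> 'a l2" is "\<lambda>f g x. f x + g x"
  by (auto intro: square_integrable_add)

lift_definition scaleR_l2 :: "real \<Rightarrow> 'a l2 \<Rightarrow> 'a l2" is "\<lambda>c f x. c * f x"
  by (auto intro: square_integrable_scale)

definition uminus_l2 :: "'a l2 \<Rightarrow> 'a l2" where
  "uminus_l2 u = (-1) *\<^sub>R u"

definition minus_l2 :: "'a l2 \<Rightarrow> 'a l2 \<Rightarrow> 'a l2" where
  "minus_l2 u v = u + (-1) *\<^sub>R v"

instance
proof
  fix a b c :: "'a l2" and r s :: real
  show "a + b + c = a + (b + c)"
    by transfer (auto intro!: square_integrable_add simp: add.assoc)
  show "a + b = b + a"
    by transfer (auto intro!: square_integrable_add simp: add.commute)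
  show "0 + a = a"
    by transfer auto
  show "- a + a = 0"
    unfolding uminus_l2_def
    by transfer (auto simp: square_integrable_zero)
  show "a - b = a + - b"
    by (simp add: minus_l2_def uminus_l2_def)
  show "r *\<^sub>R (a + b) = r *\<^sub>R a + r *\<^sub>R b"
    by transfer (auto intro!: square_integrable_add square_integrable_scale simp: algebra_simps)
  show "(r + s) *\<^sub>R a = r *\<^sub>R a + s *\<^sub>R a"
    by transfer (auto intro!: square_integrable_add square_integrable_scale simp: algebra_simps)
  show "r *\<^sub>R s *\<^sub>R a = (r * s) *\<^sub>R a"
    by transfer (auto intro!: square_integrable_scale simp: algebra_simps)
  show "1 *\<^sub>R a = a"
    by transfer auto
qed

end

instantiation l2 :: (euclidean_space) real_inner
begin

lift_definition inner_l2 :: "'a l2 \<Rightarrow> 'a l2 \<Rightarrow> real" is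
  "\<lambda>f g. integral\<^sup>L lebesgue (\<lambda>x. f x * g x)"
proof -
  fix f f' g g' :: "'a \<Rightarrow> real"
  assume f: "square_integrable f \<and> square_integrable f' \<and> (AE x in lebesgue. f x = f' x)"
    and g: "square_integrable g \<and> square_integrable g' \<and> (AE x in lebesgue. g x = g' x)"
  show "integral\<^sup>L lebesgue (\<lambda>x. f x * g x) = integral\<^sup>L lebesgue (\<lambda>x. f' x * g' x)"
  proof (rule integral_cong_AE)
    show "AE x in lebesgue. f x * g x = f' x * g' x"
      using f g by auto
  qed (use f g in \<open>auto simp: square_integrable_def\<close>)
qed

definition norm_l2 :: "'a l2 \<Rightarrow> real" where
  "norm_l2 u = sqrt (inner u u)"

definition dist_l2 :: "'a l2 \<Rightarrow> 'a l2 \<Rightarrow> real" where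
  "dist_l2 u v = norm (u - v)"

definition sgn_l2 :: "'a l2 \<Rightarrow> 'a l2" where
  "sgn_l2 u = inverse (norm u) *\<^sub>R u"

definition uniformity_l2 :: "('a l2 \<times> 'a l2) filter" where
  "uniformity_l2 = (INF e\<in>{0<..}. principal {(u, v). dist u v < e})"

definition open_l2 :: "'a l2 set \<Rightarrow> bool" where
  "open_l2 S \<longleftrightarrow> (\<forall>u\<in>S. \<forall>\<^sub>F (u', v) in uniformity. u' = u \<longrightarrow> v \<in> S)"

instance
proof
  fix u v w :: "'a l2" and r :: real and S :: "'a l2 set"
  show "dist u v = norm (u - v)" by (rule dist_l2_def)
  show "sgn u = u /\<^sub>R norm u" by (rule sgn_l2_def)
  show "uniformity = (INF e\<in>{0<..}. principal {(x, y :: 'a l2). dist x y < e})"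
    by (rule uniformity_l2_def)
  show "open S \<longleftrightarrow> (\<forall>x\<in>S. \<forall>\<^sub>F (x', y) in uniformity. x' = x \<longrightarrow> y \<in> S)"
    by (rule open_l2_def)
  show "norm u = sqrt (inner u u)" by (rule norm_l2_def)
  show "inner u v = inner v u"
    by transfer (simp add: mult.commute)
  show "inner (u + v) w = inner u w + inner v w"
    by transfer (simp add: distrib_right square_integrable_mult)
  show "inner (r *\<^sub>R u) v = r * inner u v"
    by transfer (simp add: mult.assoc)
  show "0 \<le> inner u u"
    by transfer simp
  show "inner u u = 0 \<longleftrightarrow> u = 0"
  proof transfer
    fix f :: "'a \<Rightarrow> real"
    assume f: "square_integrable f \<and> square_integrable f \<and> (AE x in lebesgue. f x = f x)"
    then have "integral\<^sup>L lebesgue (\<lambda>x. f x * f x) = 0 \<longleftrightarrow> (AE x in lebesgue. f x * f x = 0)"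
      by (intro integral_nonneg_eq_0_iff_AE) (auto intro: square_integrable_mult)
    then show "integral\<^sup>L lebesgue (\<lambda>x. f x * f x) = 0 \<longleftrightarrow>
        (square_integrable f \<and> square_integrable (\<lambda>x::'a. 0) \<and> (AE x in lebesgue. f x = 0))"
      using f by (simp add: square_integrable_zero)
  qed
qed

end

text \<open>
  The class of a function modulo equality almost everywhere; only meaningful for
  square-integrable functions.
\<close>

definition l2_class :: "('a::euclidean_space \<Rightarrow> real) \<Rightarrow> 'a l2" where
  "l2_class f = abs_l2 f"

lemma l2_class_eq_iff:
  assumes "square_integrable f" "square_integrable g"
  shows "l2_class f = l2_class g \<longleftrightarrow> (AE x in lebesgue. f x = g x)"
  unfolding l2_class_def using Quotient_rel[OF Quotient_l2, of f g] assms by auto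

lemma inner_l2_class:
  assumes "square_integrable f" "square_integrable g"
  shows "inner (l2_class f) (l2_class g) = integral\<^sup>L lebesgue (\<lambda>x. f x * g x)"
  unfolding l2_class_def using assms by (simp add: inner_l2.abs_eq)


section \<open>Smooth maps and orthogonal projection\<close>

text \<open>
  The domain is finite-dimensional, so continuity of all directional derivatives is the same as
  continuity of the Frechet derivative in operator norm, and the recursion describes
  $k$-fold continuous Frechet differentiability.
\<close>

primrec Ck_on :: "nat \<Rightarrow> 'a::euclidean_space set \<Rightarrow> ('a \<Rightarrow> 'b::real_normed_vector) \<Rightarrow> bool" where
  "Ck_on 0 U F \<longleftrightarrow> continuous_on U F"
| "Ck_on (Suc k) U F \<longleftrightarrow>
     (\<forall>x\<in>U. F differentiable (at x)) \<and>
     (\<forall>v. Ck_on k U (\<lambda>x. frechet_derivative F (at x) v))"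

definition smooth_map_on :: "'a::euclidean_space set \<Rightarrow> ('a \<Rightarrow> 'b::real_normed_vector) \<Rightarrow> bool" where
  "smooth_map_on U F \<longleftrightarrow> (\<forall>k. Ck_on k U F)"

definition orth_proj :: "'b::real_inner set \<Rightarrow> 'b \<Rightarrow> 'b" where
  "orth_proj S v = (THE w. w \<in> S \<and> (\<forall>z\<in>S. orthogonal (v - w) z))"

lemma orth_proj_unique:
  fixes S :: "'b::real_inner set"
  assumes "subspace S" "w \<in> S" "\<forall>z\<in>S. orthogonal (v - w) z"
    and "w' \<in> S" "\<forall>z\<in>S. orthogonal (v - w') z"
  shows "w' = w"
proof -
  have "w' - w \<in> S" using assms by (simp add: subspace_diff)
  then have "inner (v - w) (w' - w) = 0" "inner (v - w') (w' - w) = 0"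
    using assms by (auto simp: orthogonal_def)
  then have "inner (w' - w) (w' - w) = 0" by (simp add: inner_diff_left)
  then show ?thesis by simp
qed

lemma orth_proj_exists:
  fixes B :: "'b::real_inner set"
  assumes "finite B"
  shows "\<exists>w\<in>span B. \<forall>z\<in>span B. orthogonal (v - w) z"
  using assms
proof (induction B arbitrary: v)
  case empty
  then show ?case by (simp add: orthogonal_def)
next
  case (insert a B)
  obtain c where c: "c \<in> span B" "\<forall>z\<in>span B. orthogonal (a - c) z"
    using insert.IH by blast
  obtain w where w: "w \<in> span B" "\<forall>z\<in>span B. orthogonal (v - w) z"
    using insert.IH by blast
  define r where "r = inner (v - w) (a - c) / inner (a - c) (a - c)"
  define u where "u = w + r *\<^sub>R (a - c)"
  have sub: "span B \<subseteq> span (insert a B)" by (rule span_mono) auto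
  have "a - c \<in> span (insert a B)"
    using c sub by (meson insertI1 span_base span_diff subsetD)
  then have "u \<in> span (insert a B)"
    using w sub unfolding u_def by (meson span_add span_scale subsetD)
  moreover have "orthogonal (v - u) z" if z: "z \<in> span (insert a B)" for z
  proof -
    obtain k where k: "z - k *\<^sub>R a \<in> span B"
      using z span_breakdown_eq by blast
    define y where "y = (z - k *\<^sub>R a) + k *\<^sub>R c"
    have y: "y \<in> span B" using k c unfolding y_def by (meson span_add span_scale)
    have "z = y + k *\<^sub>R (a - c)" by (simp add: y_def algebra_simps)
    moreover have "inner (v - w) y = 0" "inner (a - c) y = 0"
      using w c y by (auto simp: orthogonal_def)
    moreover have "inner (v - w) (a - c) = r * inner (a - c) (a - c)"
      by (cases "a = c") (simp_all add: r_def)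
    moreover have "inner (v - u) x = inner (v - w) x - r * inner (a - c) x" for x
      by (simp add: u_def inner_diff_left inner_add_left algebra_simps)
    ultimately show ?thesis
      by (simp add: orthogonal_def inner_add_right)
  qed
  ultimately show ?case by blast
qed

lemma orth_proj:
  fixes B :: "'b::real_inner set"
  assumes "finite B"
  shows "orth_proj (span B) v \<in> span B"
    and "z \<in> span B \<Longrightarrow> orthogonal (v - orth_proj (span B) v) z"
proof -
  have "\<exists>!w. w \<in> span B \<and> (\<forall>z\<in>span B. orthogonal (v - w) z)"
    using orth_proj_exists[OF assms] orth_proj_unique[OF subspace_span] by blast
  then have *: "orth_proj (span B) v \<in> span B \<and>
      (\<forall>z\<in>span B. orthogonal (v - orth_proj (span B) v) z)"
    unfolding orth_proj_def by (rule theI')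
  show "orth_proj (span B) v \<in> span B" using * by blast
  show "z \<in> span B \<Longrightarrow> orthogonal (v - orth_proj (span B) v) z" using * by blast
qed


section \<open>Smooth families in the Hellinger sense\<close>

definition prob_density :: "('a::euclidean_space \<Rightarrow> real) \<Rightarrow> bool" where
  "prob_density p \<longleftrightarrow> (AE x in lebesgue. 0 < p x) \<and> has_bochner_integral lebesgue p 1"

definition sqrt_density :: "('a::euclidean_space \<Rightarrow> real) \<Rightarrow> 'a l2" where
  "sqrt_density p = l2_class (\<lambda>x. sqrt (p x))"

text \<open>
  The partial derivative of $\theta \mapsto \sqrt{p(\theta)}$ as an $L^2$-valued map. By the chain rule
  it is $\partial_{\theta_i} p / (2\sqrt p)$, the derivative of $p$ being taken in $L^1$.
\<close>

definition tangent_vec ::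
  "(real^'m \<Rightarrow> 'a::euclidean_space \<Rightarrow> real) \<Rightarrow> real^'m \<Rightarrow> 'm::finite \<Rightarrow> 'a l2" where
  "tangent_vec p \<theta> i = frechet_derivative (\<lambda>\<theta>. sqrt_density (p \<theta>)) (at \<theta>) (axis i 1)"

definition smooth_hellinger_family ::
  "(real^'m::finite) set \<Rightarrow> (real^'m \<Rightarrow> 'a::euclidean_space \<Rightarrow> real) \<Rightarrow> bool" where
  "smooth_hellinger_family U p \<longleftrightarrow>
     open U \<and>
     (\<forall>\<theta>\<in>U. prob_density (p \<theta>)) \<and>
     smooth_map_on U (\<lambda>\<theta>. sqrt_density (p \<theta>)) \<and>
     (\<forall>\<theta>\<in>U. inj (tangent_vec p \<theta>) \<and> independent (range (tangent_vec p \<theta>)))"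

definition hellinger_proj ::
  "(real^'m::finite \<Rightarrow> 'a::euclidean_space \<Rightarrow> real) \<Rightarrow> real^'m \<Rightarrow> ('a \<Rightarrow> real) \<Rightarrow> 'a l2" where
  "hellinger_proj p \<theta> g = orth_proj (span (range (tangent_vec p \<theta>))) (l2_class g)"

definition tangent_coords ::
  "(real^'m::finite \<Rightarrow> 'a::euclidean_space \<Rightarrow> real) \<Rightarrow> real^'m \<Rightarrow> 'a l2 \<Rightarrow> real^'m" where
  "tangent_coords p \<theta> v =
     (\<chi> i. representation (range (tangent_vec p \<theta>)) v (tangent_vec p \<theta> i))"


section \<open>Stratonovich equations and their projection\<close>

text \<open>
  A Stratonovich equation $du = A_t(u)\,dt + \sum_k B^k_t(u) \circ dY^k_t$ with time set
  $[0,\infty)$, given by its coefficients.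
\<close>

datatype ('s, 'd) strat_sde =
  Strat_SDE (drift: "real \<Rightarrow> 's \<Rightarrow> 's") (diffusion: "'d \<Rightarrow> real \<Rightarrow> 's \<Rightarrow> 's")

text \<open>
  The coefficients are restricted to the times $t \ge 0$ and to $U$, so that equality of two
  projected equations does not involve values outside their domain.
\<close>

definition hellinger_projection ::
  "(real^'m::finite) set \<Rightarrow> (real^'m \<Rightarrow> 'a::euclidean_space \<Rightarrow> real) \<Rightarrow>
   ('a \<Rightarrow> real, 'd) strat_sde \<Rightarrow> (real^'m, 'd) strat_sde" where
  "hellinger_projection U p E =
     Strat_SDE
       (\<lambda>t\<in>{0..}. \<lambda>\<theta>\<in>U. tangent_coords p \<theta>
          (hellinger_proj p \<theta> (\<lambda>x. drift E t (p \<theta>) x / (2 * sqrt (p \<theta> x)))))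
       (\<lambda>k. \<lambda>t\<in>{0..}. \<lambda>\<theta>\<in>U. tangent_coords p \<theta>
          (hellinger_proj p \<theta> (\<lambda>x. diffusion E k t (p \<theta>) x / (2 * sqrt (p \<theta> x)))))"


section \<open>The filtering equations\<close>

definition expect :: "('a::euclidean_space \<Rightarrow> real) \<Rightarrow> ('a \<Rightarrow> real) \<Rightarrow> real" where
  "expect p g = integral\<^sup>L lebesgue (\<lambda>x. g x * p x)"

text \<open>
  Classical partial derivatives through the total operator \<^const>\<open>deriv\<close>, whose value is
  unspecified wherever the derivative does not exist.
\<close>

definition partial :: "'n \<Rightarrow> (real^'n \<Rightarrow> real) \<Rightarrow> real^'n::finite \<Rightarrow> real" where
  "partial i g x = deriv (\<lambda>h. g (x + h *\<^sub>R axis i 1)) 0"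

definition forward_op ::
  "(real^'n \<Rightarrow> real^'n) \<Rightarrow> (real^'n \<Rightarrow> real^'r::finite^'n) \<Rightarrow>
   (real^'n \<Rightarrow> real) \<Rightarrow> real^'n::finite \<Rightarrow> real" where
  "forward_op f \<sigma> \<phi> x =
     - (\<Sum>i\<in>UNIV. partial i (\<lambda>y. f y $ i * \<phi> y) x)
     + 1/2 * (\<Sum>i\<in>UNIV. \<Sum>j\<in>UNIV.
         partial i (partial j (\<lambda>y. (\<sigma> y ** transpose (\<sigma> y)) $ i $ j * \<phi> y)) x)"

definition kushner_stratonovich ::
  "(real \<Rightarrow> real^'n \<Rightarrow> real^'n) \<Rightarrow> (real \<Rightarrow> real^'n \<Rightarrow> real^'r::finite^'n) \<Rightarrow>
   (real \<Rightarrow> real^'n::finite \<Rightarrow> real^'d::finite) \<Rightarrow> (real^'n \<Rightarrow> real, 'd) strat_sde" where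
  "kushner_stratonovich f \<sigma> b =
     Strat_SDE
       (\<lambda>t p x. forward_op (f t) (\<sigma> t) p x
          - 1/2 * p x * ((norm (b t x))\<^sup>2 - expect p (\<lambda>y. (norm (b t y))\<^sup>2)))
       (\<lambda>k t p x. p x * (b t x $ k - expect p (\<lambda>y. b t y $ k)))"

definition zakai ::
  "(real \<Rightarrow> real^'n \<Rightarrow> real^'n) \<Rightarrow> (real \<Rightarrow> real^'n \<Rightarrow> real^'r::finite^'n) \<Rightarrow>
   (real \<Rightarrow> real^'n::finite \<Rightarrow> real^'d::finite) \<Rightarrow> (real^'n \<Rightarrow> real, 'd) strat_sde" where
  "zakai f \<sigma> b =
     Strat_SDE
       (\<lambda>t q x. forward_op (f t) (\<sigma> t) q x - 1/2 * q x * (norm (b t x))\<^sup>2)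
       (\<lambda>k t q x. q x * b t x $ k)"

end

theory Submission
  imports Defs
begin

text \<open>
  The two equations differ only by multiples of the density itself: the Kushner--Stratonovich
  coefficients are the Zakai coefficients plus a constant in $x$ (an expectation, possibly with a
  factor) times $p$.  Dividing by $2\sqrt p$ turns this into a constant multiple of $\sqrt p$.
  Normalisation of the densities says that $\theta \mapsto \sqrt{p(\theta)}$ moves on the unit
  sphere of $L^2$, and the position vector of a curve on a sphere is orthogonal to its velocity;
  hence $\sqrt p$ is orthogonal to the tangent space (\<open>inner_sqrt_density_tangent_vec\<close>), the
  orthogonal projection kills the extra terms, and the projected equations coincide.

  Because $p > 0$ holds only almost everywhere, the quotients by $2 \sqrt p$ have their
  expected form only almost everywhere.  Lemma \<open>hellinger_proj_eq_modulo_sqrt_density\<close>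
  therefore combines the change of representative with the removal of a multiple of $\sqrt p$.
  It is used on both sides, each being compared with the same representative built from the
  functions that are assumed to be square integrable.
\<close>

text \<open>
  Transfers square integrability to the quotients by $2 \sqrt p$.  Measurability
  passes to almost everywhere equal functions because Lebesgue measure is complete.
\<close>

lemma square_integrable_cong_AE:
  fixes g h :: "'a::euclidean_space \<Rightarrow> real"
  assumes "square_integrable g" and "AE x in lebesgue. h x = g x"
  shows "square_integrable h"
proof -
  have eq: "AE x in lebesgue. g x = h x"
    using assms(2) by auto
  have h: "h \<in> borel_measurable lebesgue"
    using assms(1) eq by (auto simp: square_integrable_def intro: borel_measurable_AE)
  have "integrable lebesgue (\<lambda>x. (h x)\<^sup>2)"
  proof (subst integrable_cong_AE)
    show "integrable lebesgue (\<lambda>x. (g x)\<^sup>2)" "AE x in lebesgue. (h x)\<^sup>2 = (g x)\<^sup>2"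
      using assms by (auto simp: square_integrable_def)
  qed (use assms(1) h in \<open>auto simp: square_integrable_def\<close>)
  with h show ?thesis
    by (simp add: square_integrable_def)
qed

lemma l2_class_add_scale:
  assumes "square_integrable g" and "square_integrable h"
  shows "l2_class (\<lambda>x. g x + c * h x) = l2_class g + c *\<^sub>R l2_class h"
  using assms square_integrable_scale[of h c]
  by (simp add: l2_class_def plus_l2.abs_eq scaleR_l2.abs_eq)

lemma orth_proj_add_orthogonal:
  fixes B :: "'b::real_inner set"
  assumes "finite B" and "\<And>z. z \<in> B \<Longrightarrow> orthogonal u z"
  shows "orth_proj (span B) (v + u) = orth_proj (span B) v"
proof (rule orth_proj_unique[where v = "v + u"])
  let ?w = "orth_proj (span B) v"
  have "orthogonal u z" if "z \<in> span B" for z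
    using that assms(2) by (rule orthogonal_to_span)
  then show "\<forall>z\<in>span B. orthogonal (v + u - ?w) z"
    using orth_proj(2)[OF assms(1), of _ v]
    by (simp add: orthogonal_def inner_diff_left inner_add_left)
qed (use assms(1) orth_proj in auto)

lemma prob_density_square_integrable_sqrt:
  assumes "prob_density p"
  shows "square_integrable (\<lambda>x. sqrt (p x))"
proof -
  have p: "integrable lebesgue p" "AE x in lebesgue. (sqrt (p x))\<^sup>2 = p x"
    using assms by (auto simp: prob_density_def has_bochner_integral_iff)
  then have m: "p \<in> borel_measurable lebesgue"
    by auto
  then have "integrable lebesgue (\<lambda>x. (sqrt (p x))\<^sup>2)"
    using p by (subst integrable_cong_AE[where g = p]) auto
  with m show ?thesis
    by (simp add: square_integrable_def)
qed

lemma prob_density_inner_sqrt_density: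
  assumes "prob_density p"
  shows "inner (sqrt_density p) (sqrt_density p) = 1"
proof -
  have p: "has_bochner_integral lebesgue p 1" "AE x in lebesgue. sqrt (p x) * sqrt (p x) = p x"
    using assms by (auto simp: prob_density_def)
  have m: "p \<in> borel_measurable lebesgue"
    using p(1) by (auto simp: has_bochner_integral_iff)
  have "integral\<^sup>L lebesgue (\<lambda>x. sqrt (p x) * sqrt (p x)) = integral\<^sup>L lebesgue p"
    using p(2) m by (intro integral_cong_AE) auto
  then show ?thesis
    using p(1) prob_density_square_integrable_sqrt[OF assms]
    by (simp add: sqrt_density_def inner_l2_class has_bochner_integral_iff)
qed

text \<open>
  A differentiable map into the unit sphere has all its directional derivatives orthogonal
  to its value, as one sees by differentiating the constant squared norm.
\<close>

lemma unit_sphere_frechet_derivative_orthogonal: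
  fixes F :: "'a::real_normed_vector \<Rightarrow> 'b::real_inner"
  assumes "open U" "\<theta> \<in> U" and "F differentiable (at \<theta>)"
    and unit: "\<And>\<eta>. \<eta> \<in> U \<Longrightarrow> inner (F \<eta>) (F \<eta>) = 1"
  shows "inner (F \<theta>) (frechet_derivative F (at \<theta>) v) = 0"
proof -
  let ?D = "frechet_derivative F (at \<theta>)"
  have D: "(F has_derivative ?D) (at \<theta>)"
    using assms(3) by (simp add: frechet_derivative_works)
  have "((\<lambda>\<eta>. inner (F \<eta>) (F \<eta>)) has_derivative (\<lambda>v. inner (F \<theta>) (?D v) + inner (?D v) (F \<theta>)))
      (at \<theta>)"
    by (rule has_derivative_inner[OF D D])
  moreover have "((\<lambda>\<eta>. inner (F \<eta>) (F \<eta>)) has_derivative (\<lambda>v. 0)) (at \<theta>)"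
    by (rule has_derivative_transform_within_open[OF has_derivative_const[of 1] assms(1,2)])
      (simp add: unit)
  ultimately have "(\<lambda>v. inner (F \<theta>) (?D v) + inner (?D v) (F \<theta>)) = (\<lambda>v. 0)"
    by (rule has_derivative_unique)
  then have "inner (F \<theta>) (?D v) + inner (?D v) (F \<theta>) = 0"
    by metis
  then show ?thesis
    by (simp add: inner_commute)
qed

lemma inner_sqrt_density_tangent_vec:
  assumes "smooth_hellinger_family U p" and "\<theta> \<in> U"
  shows "inner (sqrt_density (p \<theta>)) (tangent_vec p \<theta> i) = 0"
proof -
  have "Ck_on (Suc 0) U (\<lambda>\<theta>. sqrt_density (p \<theta>))"
    using assms(1) unfolding smooth_hellinger_family_def smooth_map_on_def by blast
  then have "(\<lambda>\<theta>. sqrt_density (p \<theta>)) differentiable (at \<theta>)"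
    using assms(2) by simp
  then show ?thesis
    using assms unfolding tangent_vec_def smooth_hellinger_family_def
    by (intro unit_sphere_frechet_derivative_orthogonal)
      (auto intro: prob_density_inner_sqrt_density)
qed

text \<open>
  Adding a multiple of $\sqrt p$ moves a function orthogonally to the tangent space.  Square
  integrability of \<open>h\<close> itself is a consequence here, so that its class, and with it the
  projection, is meaningful.
\<close>

lemma hellinger_proj_eq_modulo_sqrt_density:
  assumes fam: "smooth_hellinger_family U p" "\<theta> \<in> U"
    and g: "square_integrable g"
    and h: "AE x in lebesgue. h x = g x + c * sqrt (p \<theta> x)"
  shows "hellinger_proj p \<theta> h = hellinger_proj p \<theta> g"
proof -
  have s: "square_integrable (\<lambda>x. sqrt (p \<theta> x))"
    using fam by (auto simp: smooth_hellinger_family_def intro: prob_density_square_integrable_sqrt)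
  then have gs: "square_integrable (\<lambda>x. g x + c * sqrt (p \<theta> x))"
    using g by (intro square_integrable_add square_integrable_scale)
  then have "l2_class h = l2_class (\<lambda>x. g x + c * sqrt (p \<theta> x))"
    using square_integrable_cong_AE[OF gs h] h by (simp add: l2_class_eq_iff)
  also have "\<dots> = l2_class g + c *\<^sub>R sqrt_density (p \<theta>)"
    using l2_class_add_scale[OF g s] by (simp add: sqrt_density_def)
  finally show ?thesis
    unfolding hellinger_proj_def
    using inner_sqrt_density_tangent_vec[OF fam]
    by (auto simp: orthogonal_def intro!: orth_proj_add_orthogonal)
qed

theorem mainTheorem3:
  fixes U :: "(real^'m::finite) set"
    and p :: "real^'m \<Rightarrow> real^'n::finite \<Rightarrow> real"
    and f :: "real \<Rightarrow> real^'n \<Rightarrow> real^'n"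
    and \<sigma> :: "real \<Rightarrow> real^'n \<Rightarrow> real^'r::finite^'n"
    and b :: "real \<Rightarrow> real^'n \<Rightarrow> real^'d::finite"
  assumes "smooth_hellinger_family U p"
    and "\<And>t \<theta>. t \<ge> 0 \<Longrightarrow> \<theta> \<in> U \<Longrightarrow>
           square_integrable (\<lambda>x. forward_op (f t) (\<sigma> t) (p \<theta>) x / sqrt (p \<theta> x))"
    and "\<And>t \<theta>. t \<ge> 0 \<Longrightarrow> \<theta> \<in> U \<Longrightarrow>
           square_integrable (\<lambda>x. (norm (b t x))\<^sup>2 * sqrt (p \<theta> x))"
    and "\<And>t \<theta> k. t \<ge> 0 \<Longrightarrow> \<theta> \<in> U \<Longrightarrow>
           square_integrable (\<lambda>x. b t x $ k * sqrt (p \<theta> x))"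
  shows "(\<forall>t\<ge>0. \<forall>\<theta>\<in>U.
            hellinger_proj p \<theta> (\<lambda>x. (forward_op (f t) (\<sigma> t) (p \<theta>) x
                - 1/2 * ((norm (b t x))\<^sup>2 - expect (p \<theta>) (\<lambda>y. (norm (b t y))\<^sup>2)) * p \<theta> x)
                / (2 * sqrt (p \<theta> x)))
            = hellinger_proj p \<theta> (\<lambda>x. (forward_op (f t) (\<sigma> t) (p \<theta>) x
                - 1/2 * (norm (b t x))\<^sup>2 * p \<theta> x)
                / (2 * sqrt (p \<theta> x)))
          \<and> (\<forall>k. hellinger_proj p \<theta> (\<lambda>x. (b t x $ k - expect (p \<theta>) (\<lambda>y. b t y $ k)) * p \<theta> x
                / (2 * sqrt (p \<theta> x)))
            = hellinger_proj p \<theta> (\<lambda>x. b t x $ k * p \<theta> x / (2 * sqrt (p \<theta> x)))))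
       \<and> hellinger_projection U p (kushner_stratonovich f \<sigma> b)
         = hellinger_projection U p (zakai f \<sigma> b)"
proof -
  have pos: "AE x in lebesgue. 0 < p \<theta> x" if "\<theta> \<in> U" for \<theta>
    using assms(1) that by (simp add: smooth_hellinger_family_def prob_density_def)

  have drift: "hellinger_proj p \<theta> (\<lambda>x. (forward_op (f t) (\<sigma> t) (p \<theta>) x
        - 1/2 * ((norm (b t x))\<^sup>2 - expect (p \<theta>) (\<lambda>y. (norm (b t y))\<^sup>2)) * p \<theta> x)
        / (2 * sqrt (p \<theta> x)))
      = hellinger_proj p \<theta> (\<lambda>x. (forward_op (f t) (\<sigma> t) (p \<theta>) x
        - 1/2 * (norm (b t x))\<^sup>2 * p \<theta> x) / (2 * sqrt (p \<theta> x)))"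
    if t: "t \<ge> 0" and \<theta>: "\<theta> \<in> U" for t \<theta>
  proof -
    let ?E = "expect (p \<theta>) (\<lambda>y. (norm (b t y))\<^sup>2)"
    define g where "g x = 1/2 * (forward_op (f t) (\<sigma> t) (p \<theta>) x / sqrt (p \<theta> x))
      + (- 1/4) * ((norm (b t x))\<^sup>2 * sqrt (p \<theta> x))" for x
    have g: "square_integrable g"
      unfolding g_def using assms(2,3)[OF t \<theta>]
      by (intro square_integrable_add square_integrable_scale)
    \<comment> \<open>The Kushner--Stratonovich side is the case of \<open>e\<close> the expectation, the Zakai side \<open>e = 0\<close>.\<close>
    have rep: "AE x in lebesgue. (forward_op (f t) (\<sigma> t) (p \<theta>) x
        - 1/2 * ((norm (b t x))\<^sup>2 - e) * p \<theta> x) / (2 * sqrt (p \<theta> x))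
        = g x + e / 4 * sqrt (p \<theta> x)" for e
      using pos[OF \<theta>]
    proof eventually_elim
      case (elim x)
      then have s: "sqrt (p \<theta> x) > 0" and p: "p \<theta> x = sqrt (p \<theta> x) * sqrt (p \<theta> x)"
        by auto
      have "(F - 1/2 * (N - e) * (s * s)) / (2 * s)
          = 1/2 * (F / s) + (- 1/4) * (N * s) + e / 4 * s" if "s > 0" for F N s :: real
        using that by (simp add: field_simps)
      from this[OF s] show ?case
        unfolding g_def p[symmetric] .
    qed
    from hellinger_proj_eq_modulo_sqrt_density[OF assms(1) \<theta> g rep[of ?E]]
      hellinger_proj_eq_modulo_sqrt_density[OF assms(1) \<theta> g rep[of 0]]
    show ?thesis
      by simp
  qed

  have diffusion: "hellinger_proj p \<theta> (\<lambda>x. (b t x $ k - expect (p \<theta>) (\<lambda>y. b t y $ k)) * p \<theta> x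
        / (2 * sqrt (p \<theta> x)))
      = hellinger_proj p \<theta> (\<lambda>x. b t x $ k * p \<theta> x / (2 * sqrt (p \<theta> x)))"
    if t: "t \<ge> 0" and \<theta>: "\<theta> \<in> U" for t \<theta> k
  proof -
    let ?E = "expect (p \<theta>) (\<lambda>y. b t y $ k)"
    have g: "square_integrable (\<lambda>x. 1/2 * (b t x $ k * sqrt (p \<theta> x)))"
      using assms(4)[OF t \<theta>] by (rule square_integrable_scale)
    have rep: "AE x in lebesgue. (b t x $ k - e) * p \<theta> x / (2 * sqrt (p \<theta> x))
        = 1/2 * (b t x $ k * sqrt (p \<theta> x)) + (- e / 2) * sqrt (p \<theta> x)" for e
      using pos[OF \<theta>]
    proof eventually_elim
      case (elim x)
      then have s: "sqrt (p \<theta> x) > 0" and p: "p \<theta> x = sqrt (p \<theta> x) * sqrt (p \<theta> x)"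
        by auto
      have "(B - e) * (s * s) / (2 * s) = 1/2 * (B * s) + (- e / 2) * s" if "s > 0" for B s :: real
        using that by (simp add: field_simps)
      from this[OF s] show ?case
        unfolding p[symmetric] .
    qed
    from hellinger_proj_eq_modulo_sqrt_density[OF assms(1) \<theta> g rep[of ?E]]
      hellinger_proj_eq_modulo_sqrt_density[OF assms(1) \<theta> g rep[of 0]]
    show ?thesis
      by simp
  qed

  have "hellinger_projection U p (kushner_stratonovich f \<sigma> b)
      = hellinger_projection U p (zakai f \<sigma> b)"
    unfolding hellinger_projection_def kushner_stratonovich_def zakai_def
    using drift diffusion
    by (auto simp: restrict_def fun_eq_iff mult_ac)
  with drift diffusion show ?thesis
    by blast
qed

end
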